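(* Let $X$ be a Banach space and let $Y$ be a Banach space with modulus of convexity of power $2$. Let $U\subset X$ and $V\subset Y$ be open subsets and let $f:U\to V$ be a homeomorphism such that (i) $f:U\to V$ is locally second order Lipschitz, and (ii) $f^{-1}:V\to U$ is locally Lipschitz. Then $f$ is locally convex.
   Context: Modulus of convexity of a Banach space $Y$ with closed unit ball $B_Y$: $\delta_Y(t)=\inf\{1-\|\frac{x+y}{2}\|: x,y\in B_Y,\ \|x-y\|\ge t\}$. $Y$ has modulus of convexity of power (degree) $p$ if there is a constant $c>0$ with $\delta_Y(t)\ge c\,t^p$ for all $t\in[0,2]$. For a function $f:U\to Y$ on a subset $U$ of a Banach space $X$ and $t\ge 0$, with $[x,y]=\{sx+(1-s)y:s\in[0,1]\}$, put $\omega_1(f;t)=\sup\{\|f(x)-f(y)\|:\|x-y\|\le t,\ [x,y]\subset U\}$ and $\omega_2(f;t)=\sup\{\|f(x+h)-2f(x)+f(x-h)\|:\|h\|\le t,\ [x-h,x+h]\subset U\}$. The function $f$ is Lipschitz if there is a constant $L$ with $\omega_1(f;t)\le Lt$ for all $t\ge0$; second order Lipschitz if there is a constant $L$ with $\omega_2(f;t)\le Lt^2$ for all $t\ge0$; locally (second order) Lipschitz if each point $x\in U$ has a neighborhood $W\subset U$ such that the restriction $f|_W:W\to Y$ is (second order) Lipschitz. A function $f:U\to Y$ on an open set $U\subset X$ is locally convex if each point $x\in U$ has a neighborhood base consisting of open convex subsets $U_x\subset X$ with convex images $f(U_x)\subset Y$. *)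

theory Defs
  imports "HOL-Analysis.Analysis"
begin

text \<open>
  Suprema and infima are taken in the extended reals, since the suprema may be infinite
  and the set defining the modulus of convexity is empty for \<open>t > 0\<close> if the space is trivial.
\<close>

definition modulus_of_convexity :: "'b::real_normed_vector itself \<Rightarrow> real \<Rightarrow> ereal"
  where "modulus_of_convexity _ t =
    Inf {ereal (1 - norm ((x + y) /\<^sub>R 2)) | x y :: 'b.
           x \<in> cball 0 1 \<and> y \<in> cball 0 1 \<and> norm (x - y) \<ge> t}"

definition has_modulus_of_convexity_of_power :: "'b::real_normed_vector itself \<Rightarrow> real \<Rightarrow> bool"
  where "has_modulus_of_convexity_of_power Y p \<longleftrightarrow>
    (\<exists>c>0. \<forall>t\<in>{0..2}. modulus_of_convexity Y t \<ge> ereal (c * t powr p))"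

text \<open>
  A function \<open>U \<rightarrow> Y\<close> is represented by a total function together with its domain \<open>U\<close>;
  restricting it to \<open>W \<subseteq> U\<close> amounts to replacing \<open>U\<close> by \<open>W\<close>.
\<close>

definition omega1 :: "'a::real_normed_vector set \<Rightarrow> ('a \<Rightarrow> 'b::real_normed_vector) \<Rightarrow> real \<Rightarrow> ereal"
  where "omega1 U f t =
    Sup {ereal (norm (f x - f y)) | x y. norm (x - y) \<le> t \<and> closed_segment x y \<subseteq> U}"

definition omega2 :: "'a::real_normed_vector set \<Rightarrow> ('a \<Rightarrow> 'b::real_normed_vector) \<Rightarrow> real \<Rightarrow> ereal"
  where "omega2 U f t =
    Sup {ereal (norm (f (x + h) - 2 *\<^sub>R f x + f (x - h))) | x h.
           norm h \<le> t \<and> closed_segment (x - h) (x + h) \<subseteq> U}"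

definition Lipschitz :: "'a::real_normed_vector set \<Rightarrow> ('a \<Rightarrow> 'b::real_normed_vector) \<Rightarrow> bool"
  where "Lipschitz U f \<longleftrightarrow> (\<exists>L::real. \<forall>t\<ge>0. omega1 U f t \<le> ereal (L * t))"

definition second_order_Lipschitz ::
    "'a::real_normed_vector set \<Rightarrow> ('a \<Rightarrow> 'b::real_normed_vector) \<Rightarrow> bool"
  where "second_order_Lipschitz U f \<longleftrightarrow> (\<exists>L::real. \<forall>t\<ge>0. omega2 U f t \<le> ereal (L * t\<^sup>2))"

definition locally_Lipschitz ::
    "'a::real_normed_vector set \<Rightarrow> ('a \<Rightarrow> 'b::real_normed_vector) \<Rightarrow> bool"
  where "locally_Lipschitz U f \<longleftrightarrow> (\<forall>x\<in>U. \<exists>W\<subseteq>U. x \<in> interior W \<and> Lipschitz W f)"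

definition locally_second_order_Lipschitz ::
    "'a::real_normed_vector set \<Rightarrow> ('a \<Rightarrow> 'b::real_normed_vector) \<Rightarrow> bool"
  where "locally_second_order_Lipschitz U f \<longleftrightarrow>
    (\<forall>x\<in>U. \<exists>W\<subseteq>U. x \<in> interior W \<and> second_order_Lipschitz W f)"

text \<open>
  Intended for open \<open>U\<close>; the members of the neighbourhood bases are automatically subsets of \<open>U\<close>.
\<close>

definition locally_convex_map ::
    "'a::real_normed_vector set \<Rightarrow> ('a \<Rightarrow> 'b::real_normed_vector) \<Rightarrow> bool"
  where "locally_convex_map U f \<longleftrightarrow>
    (\<forall>x\<in>U. neighbourhood_base_at x (\<lambda>W. open W \<and> convex W \<and> convex (f ` W)) (top_of_set U))"

end

theory Submission
  imports Defs
begin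

text \<open>
  Small balls of \<open>Y\<close> have convex preimages. If \<open>f a\<close> and \<open>f b\<close> lie in a ball of radius \<open>r\<close>, uniform
  convexity places their midpoint at depth at least \<open>c \<parallel>f a - f b\<parallel>\<^sup>2 / r \<ge> c \<parallel>a - b\<parallel>\<^sup>2 / (K\<^sup>2 r)\<close> inside
  the ball, whereas second order Lipschitz continuity moves \<open>f\<close> of the midpoint of \<open>a\<close> and \<open>b\<close> away
  from it by at most \<open>L \<parallel>a - b\<parallel>\<^sup>2 / 8\<close>. For small \<open>r\<close> the first quantity wins, so the preimage
  is midpoint convex; being open, it is convex.
\<close>

text \<open>Repeated midpoints reach all dyadic points of the segment from \<open>a\<close> to
  \<open>b\<close>. Openness gives balls of one radius \<epsilon> around both endpoints, and this
  radius survives every midpoint step, so a sufficiently fine dyadic point has the target point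
  inside its ball.\<close>

lemma convex_if_open_midpoint:
  fixes S :: "'a::real_normed_vector set"
  assumes "open S" and mid: "\<And>x y. x \<in> S \<Longrightarrow> y \<in> S \<Longrightarrow> midpoint x y \<in> S"
  shows "convex S"
  unfolding convex_alt
proof (intro ballI allI impI)
  fix a b and s :: real
  assume "a \<in> S" "b \<in> S" and s: "0 \<le> s \<and> s \<le> 1"
  obtain d where d: "d > 0" "ball a d \<subseteq> S"
    using \<open>open S\<close> \<open>a \<in> S\<close> open_contains_ball by blast
  obtain e where e: "e > 0" "ball b e \<subseteq> S"
    using \<open>open S\<close> \<open>b \<in> S\<close> open_contains_ball by blast
  define \<epsilon> where "\<epsilon> = min d e"
  have "\<epsilon> > 0" using d e by (simp add: \<epsilon>_def)
  have a: "a + v \<in> S" and b: "b + v \<in> S" if "norm v < \<epsilon>" for v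
    using that d e by (auto simp: \<epsilon>_def subset_iff dist_norm)
  \<comment> \<open>The claim carries all shifts \<open>v\<close> along so that the induction
    preserves the radius: the midpoint of \<open>a + v\<close> and \<open>p + v\<close> is the
    midpoint of \<open>a\<close> and \<open>p\<close>, shifted by \<open>v\<close>. Each step
    doubles the distance of \<open>s\<close> from the nearer endpoint, which halves the error on the
    way back.\<close>
  have approx: "\<exists>t. \<bar>s - t\<bar> \<le> (1/2)^n \<and> (\<forall>v. norm v < \<epsilon> \<longrightarrow> (1 - t) *\<^sub>R a + t *\<^sub>R b + v \<in> S)"
    if "0 \<le> s" "s \<le> 1" for n and s :: real
    using that
  proof (induction n arbitrary: s)
    case 0
    then show ?case using a by (intro exI[of _ 0]) auto
  next
    case (Suc n)
    show ?case
    proof (cases "s \<le> 1/2")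
      case True
      then obtain t where t: "\<bar>2 * s - t\<bar> \<le> (1/2)^n"
        "\<And>v. norm v < \<epsilon> \<Longrightarrow> (1 - t) *\<^sub>R a + t *\<^sub>R b + v \<in> S"
        using Suc.IH[of "2 * s"] Suc.prems by auto
      have "(1 - t/2) *\<^sub>R a + (t/2) *\<^sub>R b + v
          = midpoint (a + v) ((1 - t) *\<^sub>R a + t *\<^sub>R b + v)" for v
        by (simp add: midpoint_def algebra_simps add_divide_distrib flip: scaleR_2)
      moreover have "\<bar>s - t/2\<bar> \<le> (1/2)^Suc n"
        using t(1) unfolding power_Suc abs_le_iff by (simp add: field_simps)
      ultimately show ?thesis
        using t mid[OF a t(2)] by (intro exI[of _ "t/2"]) auto
    next
      case False
      then obtain t where t: "\<bar>2 * s - 1 - t\<bar> \<le> (1/2)^n"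
        "\<And>v. norm v < \<epsilon> \<Longrightarrow> (1 - t) *\<^sub>R a + t *\<^sub>R b + v \<in> S"
        using Suc.IH[of "2 * s - 1"] Suc.prems by auto
      have "(1 - (1 + t)/2) *\<^sub>R a + ((1 + t)/2) *\<^sub>R b + v
          = midpoint (b + v) ((1 - t) *\<^sub>R a + t *\<^sub>R b + v)" for v
        by (simp add: midpoint_def algebra_simps add_divide_distrib flip: scaleR_2)
      moreover have "\<bar>s - (1 + t)/2\<bar> \<le> (1/2)^Suc n"
        using t(1) unfolding power_Suc abs_le_iff by (simp add: field_simps)
      ultimately show ?thesis
        using t mid[OF b t(2)] by (intro exI[of _ "(1 + t)/2"]) auto
    qed
  qed
  \<comment> \<open>The summand 1 keeps the denominator positive when \<open>a = b\<close>.\<close>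
  obtain n where n: "(1/2)^n < \<epsilon> / (1 + norm (b - a))"
    using real_arch_pow_inv[of "\<epsilon> / (1 + norm (b - a))" "1/2"] \<open>\<epsilon> > 0\<close>
    by (auto simp: add_pos_nonneg)
  obtain t where t: "\<bar>s - t\<bar> \<le> (1/2)^n"
    "\<And>v. norm v < \<epsilon> \<Longrightarrow> (1 - t) *\<^sub>R a + t *\<^sub>R b + v \<in> S"
    using approx s by meson
  have "norm ((s - t) *\<^sub>R (b - a)) \<le> \<bar>s - t\<bar> * (1 + norm (b - a))"
    by (simp add: mult_left_mono)
  also have "\<dots> < \<epsilon>"
    using t(1) n by (simp add: pos_less_divide_eq add_pos_nonneg)
      (smt (verit, best) mult_right_mono norm_ge_zero)
  finally have "(1 - t) *\<^sub>R a + t *\<^sub>R b + (s - t) *\<^sub>R (b - a) \<in> S" by (rule t(2))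
  then show "(1 - s) *\<^sub>R a + s *\<^sub>R b \<in> S" by (simp add: algebra_simps)
qed

text \<open>Translating by \<open>z\<close> and scaling by \<open>r\<close> reduces to the unit
  ball. Scaling back turns the quadratic gain into \<open>c * (dist x y)\<^sup>2 / r\<close>; this
  growth as \<open>r\<close> shrinks is what the exponent 2 provides.\<close>

lemma modulus_of_convexity_ball:
  assumes "has_modulus_of_convexity_of_power TYPE('b::real_normed_vector) 2"
  obtains c where "c > 0"
    "\<And>z r. \<And>x y :: 'b. r > 0 \<Longrightarrow> x \<in> cball z r \<Longrightarrow> y \<in> cball z r \<Longrightarrow>
      dist z (midpoint x y) \<le> r - c * (dist x y)\<^sup>2 / r"
proof -
  obtain c where c: "c > 0"
    "\<And>t. t \<in> {0..2} \<Longrightarrow> modulus_of_convexity TYPE('b) t \<ge> ereal (c * t powr 2)"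
    using assms unfolding has_modulus_of_convexity_of_power_def by blast
  have unit: "norm ((u + v) /\<^sub>R 2) \<le> 1 - c * (norm (u - v))\<^sup>2"
    if "norm u \<le> 1" "norm v \<le> 1" for u v :: 'b
  proof -
    have "norm (u - v) \<in> {0..2}"
      using norm_triangle_ineq4[of u v] that by auto
    then have "ereal (c * (norm (u - v)) powr 2) \<le> modulus_of_convexity TYPE('b) (norm (u - v))"
      by (rule c(2))
    also have "\<dots> \<le> ereal (1 - norm ((u + v) /\<^sub>R 2))"
      unfolding modulus_of_convexity_def by (rule Inf_lower) (use that in auto)
    finally show ?thesis by simp
  qed
  show ?thesis
  proof (rule that[OF c(1)])
    fix z r and x y :: 'b
    assume r: "r > 0" and "x \<in> cball z r" "y \<in> cball z r"
    have norm_r: "norm (v /\<^sub>R r) = norm v / r" for v :: 'b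
      using r by (simp add: field_simps)
    have "norm ((x - z) /\<^sub>R r) \<le> 1" "norm ((y - z) /\<^sub>R r) \<le> 1"
      unfolding norm_r using r \<open>x \<in> cball z r\<close> \<open>y \<in> cball z r\<close>
      by (simp_all add: dist_norm norm_minus_commute)
    note unit[OF this]
    moreover have "((x - z) /\<^sub>R r + (y - z) /\<^sub>R r) /\<^sub>R 2 = (midpoint x y - z) /\<^sub>R r"
      by (simp add: midpoint_def algebra_simps flip: scaleR_2)
    moreover have "(x - z) /\<^sub>R r - (y - z) /\<^sub>R r = (x - y) /\<^sub>R r"
      by (simp add: algebra_simps)
    ultimately have "norm (midpoint x y - z) / r \<le> 1 - c * (norm (x - y) / r)\<^sup>2"
      by (simp only: norm_r)
    then have "norm (midpoint x y - z) \<le> (1 - c * (norm (x - y) / r)\<^sup>2) * r"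
      using r by (simp add: pos_divide_le_eq)
    also have "\<dots> = r - c * (norm (x - y))\<^sup>2 / r"
      using r by (simp add: field_simps power2_eq_square)
    finally show "dist z (midpoint x y) \<le> r - c * (dist x y)\<^sup>2 / r"
      by (simp add: dist_norm norm_minus_commute)
  qed
qed

lemma locally_LipschitzE:
  assumes "locally_Lipschitz U f" "x \<in> U"
  obtains r K where "r > 0" "K > 0" "ball x r \<subseteq> U"
    "\<And>a b. a \<in> ball x r \<Longrightarrow> b \<in> ball x r \<Longrightarrow> dist (f a) (f b) \<le> K * dist a b"
proof -
  obtain W L where W: "W \<subseteq> U" "x \<in> interior W"
    and L: "\<And>t. t \<ge> 0 \<Longrightarrow> omega1 W f t \<le> ereal (L * t)"
    using assms unfolding locally_Lipschitz_def Lipschitz_def by blast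
  obtain r where r: "r > 0" "ball x r \<subseteq> W"
    using W(2) by (meson mem_interior)
  show ?thesis
  \<comment> \<open>The given \<open>L\<close> may fail to be positive, hence the maximum. In a ball
    every segment between two points stays inside, so all pairs are admissible in
    \<open>omega1\<close>.\<close>
  proof (rule that[of r "max L 1"])
    fix a b assume "a \<in> ball x r" "b \<in> ball x r"
    then have seg: "closed_segment a b \<subseteq> W"
      using closed_segment_subset[OF _ _ convex_ball] r(2) by blast
    have "ereal (norm (f a - f b)) \<le> omega1 W f (norm (a - b))"
      unfolding omega1_def by (rule Sup_upper) (use seg in auto)
    also have "\<dots> \<le> ereal (L * norm (a - b))" by (rule L) simp
    finally have "dist (f a) (f b) \<le> L * dist a b" by (simp add: dist_norm)
    also have "\<dots> \<le> max L 1 * dist a b" by (simp add: mult_right_mono)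
    finally show "dist (f a) (f b) \<le> max L 1 * dist a b" .
  qed (use r W in auto)
qed

lemma locally_second_order_LipschitzE:
  assumes "locally_second_order_Lipschitz U f" "x \<in> U"
  obtains r L where "r > 0" "L > 0" "ball x r \<subseteq> U"
    "\<And>a b. a \<in> ball x r \<Longrightarrow> b \<in> ball x r \<Longrightarrow>
      dist (f (midpoint a b)) (midpoint (f a) (f b)) \<le> L * (dist a b)\<^sup>2"
proof -
  obtain W L where W: "W \<subseteq> U" "x \<in> interior W"
    and L: "\<And>t. t \<ge> 0 \<Longrightarrow> omega2 W f t \<le> ereal (L * t\<^sup>2)"
    using assms unfolding locally_second_order_Lipschitz_def second_order_Lipschitz_def by blast
  obtain r where r: "r > 0" "ball x r \<subseteq> W"
    using W(2) by (meson mem_interior)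
  show ?thesis
  \<comment> \<open>The second difference at the midpoint with step
    \<open>h = (a - b) /\<^sub>R 2\<close> is twice the deviation of \<open>f\<close> from midpoint
    affinity. This factor 2 and \<open>(norm h)\<^sup>2 = (dist a b)\<^sup>2 / 4\<close> give
    \<open>L / 8\<close>.\<close>
  proof (rule that[of r "max (L / 8) 1"])
    fix a b assume "a \<in> ball x r" "b \<in> ball x r"
    then have seg: "closed_segment b a \<subseteq> W"
      using closed_segment_subset[OF _ _ convex_ball] r(2) by blast
    define m h where "m = midpoint a b" and "h = (a - b) /\<^sub>R 2"
    have ab: "m + h = a" "m - h = b"
      by (simp_all add: m_def h_def midpoint_def algebra_simps flip: scaleR_left_distrib)
    have "ereal (norm (f (m + h) - 2 *\<^sub>R f m + f (m - h))) \<le> omega2 W f (norm h)"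
      unfolding omega2_def by (rule Sup_upper) (use seg ab in auto)
    also have "\<dots> \<le> ereal (L * (norm h)\<^sup>2)" by (rule L) simp
    finally have le: "norm (f a - 2 *\<^sub>R f m + f b) \<le> L * (norm h)\<^sup>2" by (simp add: ab)
    have "f a - 2 *\<^sub>R f m + f b = 2 *\<^sub>R (midpoint (f a) (f b) - f m)"
      by (simp add: midpoint_def algebra_simps)
    then have "2 * dist (f m) (midpoint (f a) (f b)) = norm (f a - 2 *\<^sub>R f m + f b)"
      by (simp add: dist_norm norm_minus_commute)
    also note le
    also have "L * (norm h)\<^sup>2 = 2 * (L / 8 * (dist a b)\<^sup>2)"
      by (simp add: h_def dist_norm power2_eq_square)
    also have "\<dots> \<le> 2 * (max (L / 8) 1 * (dist a b)\<^sup>2)"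
      by (intro mult_left_mono mult_right_mono) auto
    finally show "dist (f (midpoint a b)) (midpoint (f a) (f b)) \<le> max (L / 8) 1 * (dist a b)\<^sup>2"
      by (simp add: m_def)
  qed (use r W in auto)
qed

theorem theorem2:
  fixes U :: "'a::banach set" and V :: "'b::banach set"
    and f :: "'a \<Rightarrow> 'b" and g :: "'b \<Rightarrow> 'a"
  assumes "has_modulus_of_convexity_of_power TYPE('b) 2"
    and "open U" and "open V"
    and "homeomorphism U V f g"
    and "locally_second_order_Lipschitz U f"
    and "locally_Lipschitz V g"
  shows "locally_convex_map U f"
  unfolding locally_convex_map_def neighbourhood_base_at_def
proof (intro ballI allI impI)
  fix x0 N
  assume x0: "x0 \<in> U" and N: "openin (top_of_set U) N \<and> x0 \<in> N"
  have fU: "f ` U = V" and gV: "g ` V = U" and gf: "\<And>x. x \<in> U \<Longrightarrow> g (f x) = x"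
    and fg: "\<And>y. y \<in> V \<Longrightarrow> f (g y) = y" and contf: "continuous_on U f" and contg: "continuous_on V g"
    using assms(4) by (auto simp: homeomorphism_def)
  define y0 where "y0 = f x0"
  have y0: "y0 \<in> V" "g y0 = x0" using fU x0 gf by (auto simp: y0_def)
  obtain c where c: "c > 0"
    "\<And>z r. \<And>x y :: 'b. r > 0 \<Longrightarrow> x \<in> cball z r \<Longrightarrow> y \<in> cball z r \<Longrightarrow>
      dist z (midpoint x y) \<le> r - c * (dist x y)\<^sup>2 / r"
    using modulus_of_convexity_ball[OF assms(1)] by metis
  obtain \<rho> L where L: "\<rho> > 0" "L > 0" "ball x0 \<rho> \<subseteq> U"
    "\<And>a b. a \<in> ball x0 \<rho> \<Longrightarrow> b \<in> ball x0 \<rho> \<Longrightarrow>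
      dist (f (midpoint a b)) (midpoint (f a) (f b)) \<le> L * (dist a b)\<^sup>2"
    using locally_second_order_LipschitzE[OF assms(5) x0] by metis
  obtain \<sigma> K where K: "\<sigma> > 0" "K > 0" "ball y0 \<sigma> \<subseteq> V"
    "\<And>a b. a \<in> ball y0 \<sigma> \<Longrightarrow> b \<in> ball y0 \<sigma> \<Longrightarrow> dist (g a) (g b) \<le> K * dist a b"
    using locally_LipschitzE[OF assms(6) y0(1)] by metis
  \<comment> \<open>Continuity of \<open>g\<close> turns the location constraints near
    \<open>x0\<close> into a radius \<tau> around \<open>y0\<close>.\<close>
  have "open (N \<inter> ball x0 \<rho>)" using N assms(2) by (auto simp: openin_open_eq)
  then have "open (V \<inter> g -` (N \<inter> ball x0 \<rho>))"
    using contg assms(3) by (simp add: continuous_on_open_vimage Int_commute del: vimage_Int)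
  then obtain \<tau> where \<tau>: "\<tau> > 0" "ball y0 \<tau> \<subseteq> V \<inter> g -` (N \<inter> ball x0 \<rho>)"
    using y0 N L(1) by (metis (no_types, lifting) IntI centre_in_ball openE vimageI)
  \<comment> \<open>The bound \<sigma> makes the Lipschitz estimate for \<open>g\<close> available,
    \<tau> keeps the preimage inside \<open>N\<close> and \<open>ball x0 \<rho>\<close>, and the
    last one gives \<open>L * K\<^sup>2 \<le> c / (2 * r)\<close>, where the 2 yields a strict
    inequality below.\<close>
  define r where "r = Min {\<sigma>, \<tau>, c / (2 * L * K\<^sup>2)}"
  have r: "r > 0" "r \<le> \<sigma>" "r \<le> \<tau>" "r \<le> c / (2 * L * K\<^sup>2)"
    using K L \<tau> c by (auto simp: r_def)
  then have rLK: "L * K\<^sup>2 < c / r"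
    using K L c by (simp add: field_simps)
  \<comment> \<open>The image of this set is a whole ball, as the ball lies in \<open>V\<close>;
    hence only the convexity of \<open>W\<close> itself requires work.\<close>
  define W where "W = U \<inter> f -` ball y0 r"
  have fW: "f ` W = ball y0 r"
  proof
    show "ball y0 r \<subseteq> f ` W"
    proof
      fix y assume y: "y \<in> ball y0 r"
      then have "y \<in> V" using r \<tau> by auto
      then show "y \<in> f ` W" using y fg gV by (force simp: W_def)
    qed
  qed (auto simp: W_def)
  have W: "a \<in> U" "a \<in> N" "a \<in> ball x0 \<rho>" "f a \<in> ball y0 r" "f a \<in> ball y0 \<sigma>" if "a \<in> W" for a
  proof -
    show *: "a \<in> U" "f a \<in> ball y0 r" "f a \<in> ball y0 \<sigma>" using that r by (auto simp: W_def)
    then have "f a \<in> ball y0 \<tau>" using r by auto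
    then have "g (f a) \<in> N \<inter> ball x0 \<rho>" using \<tau> by blast
    then show "a \<in> N" "a \<in> ball x0 \<rho>" using gf * by auto
  qed
  have "open W"
    unfolding W_def using contf assms(2) by (auto simp: continuous_on_open_vimage Int_commute)
  moreover have "convex W"
  proof (rule convex_if_open_midpoint[OF \<open>open W\<close>])
    fix a b assume a: "a \<in> W" and b: "b \<in> W"
    show "midpoint a b \<in> W"
    \<comment> \<open>The strict gain below requires \<open>f a\<close> and \<open>f b\<close> to be
      distinct.\<close>
    proof (cases "a = b")
      case False
      \<comment> \<open>\<open>U\<close> may fail to be convex; the midpoint stays in it because
        \<open>a\<close> and \<open>b\<close> lie in \<open>ball x0 \<rho>\<close>.\<close>
      have m: "midpoint a b \<in> U"
        using closed_segment_subset[OF W(3)[OF a] W(3)[OF b] convex_ball] L(3) midpoint_in_closed_segment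
        by blast
      \<comment> \<open>The Lipschitz bound for \<open>g\<close> acts as a lower bound for the
        distance of \<open>f a\<close> and \<open>f b\<close>, so the convexity gain can be measured
        against \<open>(dist a b)\<^sup>2\<close>.\<close>
      have "dist a b \<le> K * dist (f a) (f b)"
        using K(4)[OF W(5)[OF a] W(5)[OF b]] gf W(1) a b by simp
      then have "(dist a b)\<^sup>2 \<le> K\<^sup>2 * (dist (f a) (f b))\<^sup>2"
        by (metis power_mono power_mult_distrib zero_le_dist)
      then have "L * (dist a b)\<^sup>2 \<le> L * K\<^sup>2 * (dist (f a) (f b))\<^sup>2"
        using L(2) by (simp add: mult.assoc)
      also have "\<dots> < c / r * (dist (f a) (f b))\<^sup>2"
        using False gf[OF W(1)[OF a]] gf[OF W(1)[OF b]] by (intro mult_strict_right_mono rLK) auto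
      finally have less: "L * (dist a b)\<^sup>2 < c * (dist (f a) (f b))\<^sup>2 / r" by simp
      have "dist y0 (f (midpoint a b)) \<le> dist y0 (midpoint (f a) (f b))
          + dist (f (midpoint a b)) (midpoint (f a) (f b))"
        by (metis dist_commute dist_triangle)
      also have "\<dots> \<le> r - c * (dist (f a) (f b))\<^sup>2 / r + L * (dist a b)\<^sup>2"
        using W[OF a] W[OF b] r(1) by (intro add_mono c(2) L(4)) auto
      also have "\<dots> < r" using less by simp
      finally show ?thesis using m by (simp add: W_def)
    qed (use a in simp)
  qed
  moreover have "x0 \<in> W" using x0 r(1) by (simp add: W_def y0_def)
  moreover have "openin (top_of_set U) W"
    using \<open>open W\<close> W(1) by (simp add: open_subset subsetI)
  ultimately show "\<exists>W W'. openin (top_of_set U) W \<and> (open W' \<and> convex W' \<and> convex (f ` W'))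
      \<and> x0 \<in> W \<and> W \<subseteq> W' \<and> W' \<subseteq> N"
    using fW W(2) by (intro exI[of _ W]) auto
qed

end
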